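(* Let $\mathcal{Z}$ be a nonempty Borel subset of the real matrix space $\mathbb{R}^{m\times d}$, let $\sigma>0$, and let $K:\mathcal{Z}\times\mathcal{Z}\to\mathbb{R}$ be the exponential kernel $K(\mathbf{Z},\mathbf{Z}')=\exp\left(-\|\mathbf{Z}-\mathbf{Z}'\|/(2\sigma^2)\right)$, with reproducing kernel Hilbert space $\mathcal{H}$. Let $\mathbb{P}$ and $\mathbb{Q}$ be Borel probability distributions on $\mathcal{Z}$, and let $f^*\in\mathcal{H}$ be a discrimination function that maximizes the discrepancy between $\mathbb{P}$ and $\mathbb{Q}$, i.e. $\|f^*\|_{\mathcal{H}}\le 1$ and $$\left|\mathbb{E}_{\mathbf{Z}\sim\mathbb{P}}[f^*(\mathbf{Z})]-\mathbb{E}_{\hat{\mathbf{Z}}\sim\mathbb{Q}}[f^*(\hat{\mathbf{Z}})]\right|=\sup_{f\in\mathcal{H},\ \|f\|_{\mathcal{H}}\le 1}\left|\mathbb{E}_{\mathbf{Z}\sim\mathbb{P}}[f(\mathbf{Z})]-\mathbb{E}_{\hat{\mathbf{Z}}\sim\mathbb{Q}}[f(\hat{\mathbf{Z}})]\right|.$$ Suppose that $f^*$ lies in the linear span of finitely many kernel functions, $f^*\in\operatorname{span}\{K(\cdot,\mathbf{Z}_k)\}_{k=1}^{\mathrm{K}}$, for some points $\mathbf{Z}_1,\dots,\mathbf{Z}_{\mathrm{K}}\in\mathcal{Z}$. If $$\mathbb{E}_{\mathbf{Z}\sim\mathbb{P}}[K(\mathbf{Z},\mathbf{Z}_k)]=\mathbb{E}_{\hat{\mathbf{Z}}\sim\mathbb{Q}}[K(\hat{\mathbf{Z}},\mathbf{Z}_k)]\quad\text{for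 all }k\in\{1,\dots,\mathrm{K}\},$$ then $\mathbb{P}$ and $\mathbb{Q}$ are balanced.
   Context: The norm $\|\cdot\|$ on $\mathbb{R}^{m\times d}$ is the Euclidean (Frobenius) norm. The reproducing kernel Hilbert space $\mathcal{H}$ of $K$ is the Hilbert space of real functions on $\mathcal{Z}$ generated by (the completion of) the span of $\{K(\cdot,\mathbf{Z}):\mathbf{Z}\in\mathcal{Z}\}$, with the reproducing property $f(\mathbf{Z})=\langle f,K(\cdot,\mathbf{Z})\rangle_{\mathcal{H}}$. Two probability distributions $\mathbb{P},\mathbb{Q}$ on $\mathcal{Z}$ are called balanced (Imbens' criterion) if $\mathbb{E}_{\mathbf{Z}\sim\mathbb{P}}[\phi(\mathbf{Z})]=\mathbb{E}_{\mathbf{Z}\sim\mathbb{Q}}[\phi(\mathbf{Z})]$ for every balancing function $\phi$, that is, for every bounded measurable $\phi:\mathcal{Z}\to\mathbb{R}$; equivalently, $\mathbb{P}=\mathbb{Q}$. The discrepancy between $\mathbb{P}$ and $\mathbb{Q}$ is the maximum mean discrepancy, the supremum of $|\mathbb{E}_{\mathbb{P}}[f]-\mathbb{E}_{\mathbb{Q}}[f]|$ over the unit ball of $\mathcal{H}$. *)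

theory Defs
  imports "HOL-Probability.Probability"
begin

text \<open>
  A real function on a set \<open>X\<close> is represented by a total function that vanishes outside \<open>X\<close>, so
  that equality of functions on \<open>X\<close> is equality in HOL and the vector space operations are pointwise.
\<close>

definition ip_norm :: "(('a \<Rightarrow> real) \<Rightarrow> ('a \<Rightarrow> real) \<Rightarrow> real) \<Rightarrow> ('a \<Rightarrow> real) \<Rightarrow> real" where
  "ip_norm ip f = sqrt (ip f f)"

locale hilbert_function_space =
  fixes X :: "'a set"
    and H :: "('a \<Rightarrow> real) set"
    and ip :: "('a \<Rightarrow> real) \<Rightarrow> ('a \<Rightarrow> real) \<Rightarrow> real"
  assumes zero_outside: "f \<in> H \<Longrightarrow> x \<notin> X \<Longrightarrow> f x = 0"
    and zero_mem: "(\<lambda>x. 0) \<in> H"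
    and add_mem: "f \<in> H \<Longrightarrow> g \<in> H \<Longrightarrow> (\<lambda>x. f x + g x) \<in> H"
    and scale_mem: "f \<in> H \<Longrightarrow> (\<lambda>x. c * f x) \<in> H"
    and ip_commute: "f \<in> H \<Longrightarrow> g \<in> H \<Longrightarrow> ip f g = ip g f"
    and ip_add_left: "f \<in> H \<Longrightarrow> g \<in> H \<Longrightarrow> h \<in> H \<Longrightarrow> ip (\<lambda>x. f x + g x) h = ip f h + ip g h"
    and ip_scale_left: "f \<in> H \<Longrightarrow> g \<in> H \<Longrightarrow> ip (\<lambda>x. c * f x) g = c * ip f g"
    and ip_nonneg: "f \<in> H \<Longrightarrow> 0 \<le> ip f f"
    and ip_definite: "f \<in> H \<Longrightarrow> ip f f = 0 \<Longrightarrow> f = (\<lambda>x. 0)"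
    and complete:
      "(\<And>n. F n \<in> H) \<Longrightarrow>
       (\<And>e. e > 0 \<Longrightarrow> \<exists>N. \<forall>i\<ge>N. \<forall>j\<ge>N. ip_norm ip (\<lambda>x. F i x - F j x) < e) \<Longrightarrow>
       \<exists>f\<in>H. (\<lambda>n. ip_norm ip (\<lambda>x. F n x - f x)) \<longlonglongrightarrow> 0"

definition kernel_section :: "'a set \<Rightarrow> ('a \<Rightarrow> 'a \<Rightarrow> real) \<Rightarrow> 'a \<Rightarrow> 'a \<Rightarrow> real" where
  "kernel_section X K w = (\<lambda>x. if x \<in> X then K x w else 0)"

definition kernel_span :: "'a set \<Rightarrow> ('a \<Rightarrow> 'a \<Rightarrow> real) \<Rightarrow> 'a set \<Rightarrow> ('a \<Rightarrow> real) set" where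
  "kernel_span X K W =
     {f. \<exists>S c. finite S \<and> S \<subseteq> W \<and> f = (\<lambda>x. \<Sum>w\<in>S. c w * kernel_section X K w x)}"

text \<open>
  The triple \<open>(X, K, (H, ip))\<close> satisfies this predicate iff \<open>H\<close> with inner product \<open>ip\<close> is the
  reproducing kernel Hilbert space of \<open>K\<close> on \<open>X\<close>; by the Moore--Aronszajn theorem \<open>H\<close> and \<open>ip\<close> on
  \<open>H\<close> are uniquely determined by \<open>K\<close>.  Outside \<open>H\<close> the values of \<open>ip\<close> are irrelevant.
\<close>

locale rkhs = hilbert_function_space X H ip
  for X :: "'a set" and K :: "'a \<Rightarrow> 'a \<Rightarrow> real"
    and H :: "('a \<Rightarrow> real) set" and ip :: "('a \<Rightarrow> real) \<Rightarrow> ('a \<Rightarrow> real) \<Rightarrow> real" +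
  assumes section_mem: "w \<in> X \<Longrightarrow> kernel_section X K w \<in> H"
    and reproducing: "f \<in> H \<Longrightarrow> w \<in> X \<Longrightarrow> f w = ip f (kernel_section X K w)"
    and span_dense:
      "f \<in> H \<Longrightarrow> e > 0 \<Longrightarrow> \<exists>g\<in>kernel_span X K X. ip_norm ip (\<lambda>x. f x - g x) < e"

text \<open>On \<^typ>\<open>real^'d^'m\<close> the library norm is the Frobenius norm.\<close>

definition exp_kernel :: "real \<Rightarrow> real^'d^'m \<Rightarrow> real^'d^'m \<Rightarrow> real" where
  "exp_kernel \<sigma> A B = exp (- norm (A - B) / (2 * \<sigma>\<^sup>2))"

definition borel_prob_on :: "'a::topological_space set \<Rightarrow> 'a measure \<Rightarrow> bool" where
  "borel_prob_on X P \<longleftrightarrow> prob_space P \<and> sets P = sets (restrict_space borel X)"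

definition mean_gap :: "'a measure \<Rightarrow> 'a measure \<Rightarrow> ('a \<Rightarrow> real) \<Rightarrow> real" where
  "mean_gap P Q f = \<bar>(LINT x|P. f x) - (LINT x|Q. f x)\<bar>"

definition mmd ::
  "('a \<Rightarrow> real) set \<Rightarrow> (('a \<Rightarrow> real) \<Rightarrow> ('a \<Rightarrow> real) \<Rightarrow> real) \<Rightarrow> 'a measure \<Rightarrow> 'a measure \<Rightarrow> real" where
  "mmd H ip P Q = (SUP f\<in>{f \<in> H. ip_norm ip f \<le> 1}. mean_gap P Q f)"

definition maximizes_discrepancy ::
  "('a \<Rightarrow> real) set \<Rightarrow> (('a \<Rightarrow> real) \<Rightarrow> ('a \<Rightarrow> real) \<Rightarrow> real) \<Rightarrow> 'a measure \<Rightarrow> 'a measure \<Rightarrow>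
   ('a \<Rightarrow> real) \<Rightarrow> bool" where
  "maximizes_discrepancy H ip P Q f \<longleftrightarrow>
     f \<in> H \<and> ip_norm ip f \<le> 1 \<and> mean_gap P Q f = mmd H ip P Q"

definition balanced :: "'a::topological_space set \<Rightarrow> 'a measure \<Rightarrow> 'a measure \<Rightarrow> bool" where
  "balanced X P Q \<longleftrightarrow>
     (\<forall>\<phi> :: 'a \<Rightarrow> real. \<phi> \<in> borel_measurable (restrict_space borel X) \<and> bounded (\<phi> ` X) \<longrightarrow>
        (LINT x|P. \<phi> x) = (LINT x|Q. \<phi> x))"

end

theory Submission
  imports Defs
begin

text \<open>
  Since \<open>f\<^sup>*\<close> is a combination of kernel sections with equal means, the maximum mean discrepancy is
  \<open>0\<close>, so \<open>P\<close> and \<open>Q\<close> have the same mean on every section \<open>K(\<cdot>,w)\<close>, \<open>w \<in> Z\<close>. It remains to see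
  that the exponential kernel is characteristic. It is a mixture of Gaussian kernels,
  \<open>exp (-2 a r) = c \<integral> exp (-(a u)\<^sup>2 - (r / u)\<^sup>2) du\<close> over \<open>u > 0\<close>, and a Gaussian kernel is an overlap
  integral of narrower Gaussians. Hence the vanishing energy of \<open>\<mu> = P - Q\<close> is a mixture of squared
  \<open>L\<^sup>2\<close> norms of Gaussian smoothings of \<open>\<mu>\<close>, so that for almost every width \<open>u\<close> the smoothing of \<open>\<mu>\<close>
  vanishes almost everywhere. Letting \<open>u \<rightarrow> 0\<close> gives \<open>P = Q\<close>.
\<close>

section \<open>The exponential as a mixture of Gaussians in one real variable\<close>

text \<open>\<open>E\<close> is the error function up to the factor \<open>sqrt pi / 2\<close>. Its
  limit at infinity is the half-line Gaussian moment, and oddness carries that limit over to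
  \<open>at_bot\<close>.\<close>

lemma gauss_antiderivative:
  obtains E :: "real \<Rightarrow> real" where
    "\<And>x. (E has_real_derivative exp (- x\<^sup>2)) (at x)" "E 0 = 0"
    "(E \<longlongrightarrow> sqrt pi / 2) at_top" "(E \<longlongrightarrow> - (sqrt pi / 2)) at_bot"
proof -
  let ?f = "\<lambda>x::real. exp (- x\<^sup>2)"
  have "\<exists>F. \<forall>x::real. -\<infinity> < ereal x \<longrightarrow> ereal x < \<infinity> \<longrightarrow> (F has_vector_derivative ?f x) (at x)"
    by (rule einterval_antiderivative) auto
  then obtain F where F: "\<And>x. (F has_real_derivative ?f x) (at x)"
    by (auto simp: has_real_derivative_iff_has_vector_derivative)
  define E where "E x = F x - F 0" for x
  have dE: "(E has_real_derivative ?f x) (at x)" for x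
    unfolding E_def using F by (auto intro!: derivative_eq_intros)
  have "((\<lambda>x. E x + E (-x)) has_real_derivative 0) (at x)" for x
    using dE[of x] DERIV_chain2[OF dE[of "-x"] DERIV_minus[OF DERIV_ident]]
    by (auto intro!: derivative_eq_intros)
  then have "E x + E (-x) = E 0 + E (-0)" for x
    by (intro DERIV_isconst_all[rule_format]) auto
  then have odd: "E (-x) = - E x" for x
    by (simp add: E_def algebra_simps)
  \<comment> \<open>The two nested indicators give the integrand the shape in which
    \<open>tendsto_integral_at_top\<close> truncates an integral at \<open>x\<close>.\<close>
  have eq: "(\<integral>t. indicator {..x} t *\<^sub>R (indicator {0..} t *\<^sub>R ?f t) \<partial>lborel) = E x" if "0 \<le> x" for x
  proof -
    have "(\<integral>t. ?f t * indicator {0..x} t \<partial>lborel) = E x - E 0"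
      by (rule integral_FTC_Icc_real[OF that]) (use dE in \<open>auto intro!: continuous_intros\<close>)
    moreover have "(\<integral>t. indicator {..x} t *\<^sub>R (indicator {0..} t *\<^sub>R ?f t) \<partial>lborel) = (\<integral>t. ?f t * indicator {0..x} t \<partial>lborel)"
      by (intro Bochner_Integration.integral_cong) (auto simp: indicator_def)
    ultimately show ?thesis by (simp add: E_def)
  qed
  have "((\<lambda>y. \<integral>t. indicator {..y} t *\<^sub>R (indicator {0..} t *\<^sub>R ?f t) \<partial>lborel) \<longlongrightarrow> (\<integral>t. indicator {0..} t *\<^sub>R ?f t \<partial>lborel)) at_top"
    using gaussian_moment_0 by (intro tendsto_integral_at_top) (auto simp: has_bochner_integral_iff)
  then have top: "(E \<longlongrightarrow> sqrt pi / 2) at_top"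
    unfolding has_bochner_integral_integral_eq[OF gaussian_moment_0]
    by (rule Lim_transform_eventually) (rule eventually_mono[OF eventually_ge_at_top[of 0]], rule eq)
  have "((\<lambda>x. - E (- x)) \<longlongrightarrow> - (sqrt pi / 2)) at_bot"
    by (intro tendsto_minus filterlim_compose[OF top] filterlim_uminus_at_top_at_bot)
  then have "(E \<longlongrightarrow> - (sqrt pi / 2)) at_bot" by (simp add: odd)
  with dE top show ?thesis by (intro that[of E]) (auto simp: E_def)
qed

text \<open>With \<open>b\<close> the distance of two points, this expresses the exponential kernel
  through Gaussian kernels of all widths \<open>u\<close>. The value \<open>b = 0\<close> is
  included for coinciding points, and it also gives the total mass of the mixing weights.\<close>

lemma exp_gauss_mixture:
  fixes a b :: real
  assumes a: "0 < a" and b: "0 \<le> b"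
  shows "has_bochner_integral lborel (\<lambda>u. indicator {0<..} u * exp (- (a * u)\<^sup>2 - (b / u)\<^sup>2))
           (sqrt pi / (2 * a) * exp (- 2 * a * b))"
proof -
  obtain E :: "real \<Rightarrow> real" where dE: "\<And>x. (E has_real_derivative exp (- x\<^sup>2)) (at x)" and E0: "E 0 = 0"
    and top: "(E \<longlongrightarrow> sqrt pi / 2) at_top" and bot: "(E \<longlongrightarrow> - (sqrt pi / 2)) at_bot"
    using gauss_antiderivative by blast
  \<comment> \<open>Explicit antiderivative of the integrand, known from \<open>\<integral> exp (-a\<^sup>2 u\<^sup>2 - b\<^sup>2 / u\<^sup>2) du\<close> in terms of erf.\<close>
  define F where "F u = (exp (2*a*b) * E (a * u + b / u) + exp (- (2*a*b)) * E (a * u - b / u)) / (2 * a)" for u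
  let ?f = "\<lambda>u. exp (- (a * u)\<^sup>2 - (b / u)\<^sup>2)"
  define A where "A = (exp (2*a*b) - exp (- (2*a*b))) * (sqrt pi / 2) / (2 * a)"
  define B where "B = (exp (2*a*b) + exp (- (2*a*b))) * (sqrt pi / 2) / (2 * a)"
  have dF: "(F has_real_derivative ?f u) (at u)" if "0 < u" for u
  proof -
    \<comment> \<open>The constant factors of \<open>F\<close> cancel the cross terms
      \<open>2*a*b\<close> of the two squares. Both summands then carry the same exponential, and
      the terms with \<open>b / u\<^sup>2\<close> cancel in the derivative.\<close>
    have 1: "exp (2*a*b) * exp (- (a * u + b / u)\<^sup>2) = ?f u" 
      using that by (simp add: exp_add[symmetric] power2_eq_square field_simps)
    have 2: "exp (- (2*a*b)) * exp (- (a * u - b / u)\<^sup>2) = ?f u" 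
      using that by (simp add: exp_add[symmetric] power2_eq_square field_simps)
    have d1: "((\<lambda>u. E (a * u + b / u)) has_real_derivative exp (- (a * u + b / u)\<^sup>2) * (a - b / u\<^sup>2)) (at u)"
      by (rule DERIV_chain2[OF dE]) (use that in \<open>auto intro!: derivative_eq_intros simp: power2_eq_square field_simps\<close>)
    have d2: "((\<lambda>u. E (a * u - b / u)) has_real_derivative exp (- (a * u - b / u)\<^sup>2) * (a + b / u\<^sup>2)) (at u)"
      by (rule DERIV_chain2[OF dE]) (use that in \<open>auto intro!: derivative_eq_intros simp: power2_eq_square field_simps\<close>)
    have "(F has_real_derivative (exp (2*a*b) * (exp (- (a * u + b / u)\<^sup>2) * (a - b / u\<^sup>2)) 
        + exp (- (2*a*b)) * (exp (- (a * u - b / u)\<^sup>2) * (a + b / u\<^sup>2))) / (2 * a)) (at u)"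
      unfolding F_def by (intro DERIV_cdivide DERIV_add DERIV_cmult d1 d2)
    moreover have "(exp (2*a*b) * (exp (- (a * u + b / u)\<^sup>2) * (a - b / u\<^sup>2)) 
        + exp (- (2*a*b)) * (exp (- (a * u - b / u)\<^sup>2) * (a + b / u\<^sup>2))) / (2 * a) = ?f u"
      unfolding mult.assoc[symmetric] 1 2 using a by (simp add: field_simps)
    ultimately show ?thesis by simp
  qed
  have inv: "filterlim (\<lambda>u::real. inverse u) at_top (at_right 0)" by (rule filterlim_inverse_at_top_right)
  have L0: "(F \<longlongrightarrow> A) (at_right 0)"
  \<comment> \<open>For \<open>b > 0\<close> the two arguments of \<open>E\<close> tend to plus and
    minus infinity. For \<open>b = 0\<close> both tend to 0, and \<open>A\<close> is 0 as
    well.\<close>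
  proof (cases "b = 0")
    case True
    have "((\<lambda>u. E (a * u)) \<longlongrightarrow> E (a * 0)) (at_right 0)"
      by (intro isCont_tendsto_compose[OF DERIV_isCont[OF dE]] tendsto_intros)
    with True show ?thesis unfolding F_def A_def
      by (auto intro!: tendsto_eq_intros simp: E0 less_imp_neq[OF a, symmetric])
  next
    case False
    with b have b: "0 < b" by simp
    have n: "filterlim (\<lambda>u. b / u) at_top (at_right 0)"
      unfolding divide_inverse by (rule filterlim_tendsto_pos_mult_at_top[OF tendsto_const b inv])
    have au: "((\<lambda>u. a * u) \<longlongrightarrow> 0) (at_right 0)" by (auto intro!: tendsto_eq_intros)
    have "((\<lambda>u. E (a * u + b / u)) \<longlongrightarrow> sqrt pi / 2) (at_right 0)"
      by (intro filterlim_compose[OF top] filterlim_tendsto_add_at_top[OF au n])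
    moreover have "filterlim (\<lambda>u. - (b / u)) at_bot (at_right 0)"
      using n by (simp add: filterlim_uminus_at_bot)
    then have "((\<lambda>u. E (a * u + - (b / u))) \<longlongrightarrow> - (sqrt pi / 2)) (at_right 0)"
      by (intro filterlim_compose[OF bot] filterlim_tendsto_add_at_bot_iff[OF au, THEN iffD2])
    ultimately show ?thesis unfolding F_def A_def
      using a by (auto intro!: tendsto_eq_intros simp: algebra_simps)
  qed
  have Linf: "(F \<longlongrightarrow> B) at_top"
  proof -
    have n: "((\<lambda>u. b / u) \<longlongrightarrow> 0) at_top"
      by (intro tendsto_divide_0[OF tendsto_const] filterlim_at_top_imp_at_infinity filterlim_ident)
    from tendsto_minus[OF this] have n': "((\<lambda>u. - (b / u)) \<longlongrightarrow> 0) at_top" by simp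
    have au: "filterlim (\<lambda>u. a * u) at_top at_top"
      by (rule filterlim_tendsto_pos_mult_at_top[OF tendsto_const a filterlim_ident])
    have "((\<lambda>u. E (b / u + a * u)) \<longlongrightarrow> sqrt pi / 2) at_top"
      by (intro filterlim_compose[OF top] filterlim_tendsto_add_at_top[OF n au])
    moreover have "((\<lambda>u. E (- (b / u) + a * u)) \<longlongrightarrow> sqrt pi / 2) at_top"
      by (intro filterlim_compose[OF top] filterlim_tendsto_add_at_top[OF n' au])
    ultimately show ?thesis unfolding F_def B_def
      using a by (auto intro!: tendsto_eq_intros simp: algebra_simps)
  qed
  \<comment> \<open>Since the integrand is nonnegative, the one-sided limits of \<open>F\<close>
    yield integrability together with the value.\<close>
  have I: "set_integrable lborel (einterval 0 \<infinity>) ?f" "(LBINT x=0..\<infinity>. ?f x) = B - A"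
    by (rule interval_integral_FTC_nonneg[where F=F],
        use dF L0 Linf in \<open>auto simp: zero_ereal_def ereal_tendsto_simps intro!: continuous_intros\<close>)+
  have e: "einterval 0 \<infinity> = {0<..}" by (auto simp: einterval_def)
  have "B - A = sqrt pi / (2 * a) * exp (- 2 * a * b)" using a by (simp add: A_def B_def field_simps)
  with I show ?thesis
    by (simp add: has_bochner_integral_iff set_integrable_def interval_lebesgue_integral_def set_lebesgue_integral_def e)
qed

section \<open>Gaussian integrals on a Euclidean space\<close>

text \<open>The integrand is a product over the coordinates, so finiteness reduces to one dimension.
  The integral is positive because a strictly positive function is not almost everywhere 0.\<close>

lemma integrable_gauss:
  fixes c :: real
  assumes "0 < c"
  shows "integrable lborel (\<lambda>v::'a::euclidean_space. exp (- c * (norm v)\<^sup>2))"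
    and "0 < (\<integral>v. exp (- c * (norm (v::'a))\<^sup>2) \<partial>lborel)"
proof -
  have 1: "integrable lborel (\<lambda>x::real. exp (- c * x\<^sup>2))"
  proof -
    \<comment> \<open>The normalizing constant of the normal density with variance
      \<open>1 / (2*c)\<close>.\<close>
    define k where "k = 1 / sqrt (2 * pi * (1 / sqrt (2*c))\<^sup>2)"
    have "k \<noteq> 0" using assms by (simp add: k_def)
    have "integrable lborel (\<lambda>x. k * exp (- c * x\<^sup>2))"
      using integrable_normal_density[of "1 / sqrt (2*c)" 0] assms
      by (simp add: normal_density_def[abs_def] power_divide ac_simps k_def)
    then have "integrable lborel (\<lambda>x. inverse k * (k * exp (- c * x\<^sup>2)))"
      by (rule integrable_mult_right)
    with \<open>k \<noteq> 0\<close> show ?thesis by (simp add: mult.assoc[symmetric])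
  qed
  have "(\<integral>\<^sup>+v. ennreal (exp (- c * (norm (v::'a))\<^sup>2)) \<partial>lborel)
      = (\<integral>\<^sup>+v. (\<Prod>b\<in>Basis. ennreal (exp (- c * ((v::'a) \<bullet> b)\<^sup>2))) \<partial>lborel)"
  proof (intro nn_integral_cong)
    fix v :: 'a
    have "(norm v)\<^sup>2 = (\<Sum>b\<in>Basis. (v \<bullet> b)\<^sup>2)"
      by (subst power2_norm_eq_inner, subst euclidean_inner) (simp add: power2_eq_square)
    then show "ennreal (exp (- c * (norm v)\<^sup>2)) = (\<Prod>b\<in>Basis. ennreal (exp (- c * (v \<bullet> b)\<^sup>2)))"
      by (simp add: prod_ennreal exp_sum[symmetric] sum_distrib_left sum_negf)
  qed
  also have "\<dots> = (\<Prod>b\<in>(Basis::'a set). (\<integral>\<^sup>+x. ennreal (exp (- c * x\<^sup>2)) \<partial>lborel))"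
    by (rule nn_integral_lborel_prod) auto
  also have "\<dots> < \<infinity>" 
    using 1 by (subst nn_integral_eq_integral) (auto simp: power_less_top_ennreal)
  finally show i: "integrable lborel (\<lambda>v::'a. exp (- c * (norm v)\<^sup>2))"
    by (intro integrableI_bounded) auto
  have "(\<integral>v. exp (- c * (norm (v::'a))\<^sup>2) \<partial>lborel) \<noteq> 0"
  proof
    assume "(\<integral>v. exp (- c * (norm (v::'a))\<^sup>2) \<partial>lborel) = 0"
    then have "AE v in (lborel :: 'a measure). False"
      using integral_nonneg_eq_0_iff_AE[OF i] by auto
    then show False
      by (simp add: eventually_False ae_filter_eq_bot_iff)
  qed
  then show "0 < (\<integral>v. exp (- c * (norm (v::'a))\<^sup>2) \<partial>lborel)"
    by (simp add: less_le)
qed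

lemma lborel_integral_affine:
  fixes f :: "'a::euclidean_space \<Rightarrow> real" and u :: real
  assumes [measurable]: "f \<in> borel_measurable borel" and u: "u \<noteq> 0"
  shows "(\<integral>z. f z \<partial>lborel) = \<bar>u\<bar> ^ DIM('a) * (\<integral>v. f (x + u *\<^sub>R v) \<partial>lborel)"
    and "integrable lborel f \<longleftrightarrow> integrable lborel (\<lambda>v. f (x + u *\<^sub>R v))"
proof -
  let ?M = "density (distr lborel borel (\<lambda>v. x + u *\<^sub>R v)) (\<lambda>_. ennreal (\<bar>u\<bar> ^ DIM('a)))"
  have M: "lborel = ?M" using lborel_affine[OF u, of x] by (simp add: ennreal_power)
  have "integral\<^sup>L ?M f = \<bar>u\<bar> ^ DIM('a) * (\<integral>v. f (x + u *\<^sub>R v) \<partial>lborel)"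
    by (simp add: integral_density integral_distr)
  with M show "(\<integral>z. f z \<partial>lborel) = \<bar>u\<bar> ^ DIM('a) * (\<integral>v. f (x + u *\<^sub>R v) \<partial>lborel)" by metis
  have "integrable ?M f \<longleftrightarrow> integrable lborel (\<lambda>v. f (x + u *\<^sub>R v))"
    using u by (simp add: integrable_density integrable_distr_eq)
  with M show "integrable lborel f \<longleftrightarrow> integrable lborel (\<lambda>v. f (x + u *\<^sub>R v))" by metis
qed

section \<open>Uniqueness from continuous test functions, and a criterion for Fubini\<close>

text \<open>The indicator of an open set is a limit of bounded continuous functions, truncated
  multiples of the distance to the complement. Open sets form a generator stable under
  intersection.\<close>

lemma prob_measure_eqI_bounded_continuous:
  fixes P Q :: "'a::metric_space measure"
  assumes "prob_space P" "prob_space Q" and sets: "sets P = sets borel" "sets Q = sets borel"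
    and eq: "\<And>f :: 'a \<Rightarrow> real. continuous_on UNIV f \<Longrightarrow> (\<And>x. \<bar>f x\<bar> \<le> 1) \<Longrightarrow> (\<integral>x. f x \<partial>P) = (\<integral>x. f x \<partial>Q)"
  shows "P = Q"
proof -
  interpret P: prob_space P by fact
  interpret Q: prob_space Q by fact
  note [measurable_cong] = sets
  have sp: "space P = UNIV" "space Q = UNIV"
    using sets_eq_imp_space_eq[OF sets(1)] sets_eq_imp_space_eq[OF sets(2)] by simp_all
  have op: "measure P U = measure Q U" if "open U" for U
  \<comment> \<open>Here the complement is empty and \<open>infdist\<close> to the empty set is 0 by
    convention, so the approximating functions would all vanish.\<close>
  proof (cases "U = UNIV")
    case True
    then show ?thesis using P.prob_space Q.prob_space sp by simp
  next
    case False
    define f where "f n x = min 1 (real n * infdist x (- U))" for n x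
    have cont: "continuous_on UNIV (f n)" for n
      unfolding f_def by (intro continuous_intros)
    have bd: "\<bar>f n x\<bar> \<le> 1" for n x by (auto simp: f_def infdist_nonneg)
    have m[measurable]: "f n \<in> borel_measurable borel" for n
      by (rule borel_measurable_continuous_onI[OF cont])
    have lim: "(\<lambda>n. f n x) \<longlonglongrightarrow> indicator U x" for x
    proof (cases "x \<in> U")
      case True
      then have "0 < infdist x (- U)"
        using in_closed_iff_infdist_zero[of "- U" x] False \<open>open U\<close> infdist_nonneg[of x "- U"] by (force simp: closed_def)
      then obtain N where N: "1 < real N * infdist x (- U)"
        using reals_Archimedean3 by blast
      have "f n x = 1" if "N \<le> n" for n
        using N mult_right_mono[of "real N" "real n" "infdist x (- U)"] that infdist_nonneg[of x "- U"]
        by (simp add: f_def)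
      then show ?thesis using True
        by (intro tendsto_eventually) (auto simp: eventually_sequentially)
    qed (simp add: f_def)
    have [measurable]: "U \<in> sets borel" using that by simp
    have "(\<lambda>n. \<integral>x. f n x \<partial>P) \<longlonglongrightarrow> (\<integral>x. indicator U x \<partial>P)"
      by (rule integral_dominated_convergence[where w="\<lambda>_. 1"]) (use lim bd in auto)
    moreover have "(\<lambda>n. \<integral>x. f n x \<partial>Q) \<longlonglongrightarrow> (\<integral>x. indicator U x \<partial>Q)"
      by (rule integral_dominated_convergence[where w="\<lambda>_. 1"]) (use lim bd in auto)
    ultimately show ?thesis
      using eq[OF cont bd] sets by (simp add: LIMSEQ_unique)
  qed
  show ?thesis
  proof (rule measure_eqI_generator_eq[where E="Collect open" and \<Omega>=UNIV and A="\<lambda>_. UNIV"])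
    show "Int_stable (Collect open :: 'a set set)" by (auto simp: Int_stable_def)
    show "sets P = sigma_sets UNIV (Collect open)" "sets Q = sigma_sets UNIV (Collect open)"
      using sets by (simp_all add: borel_def)
  qed (use op P.emeasure_eq_measure Q.emeasure_eq_measure in auto)
qed

text \<open>A uniform bound on the fibrewise \<open>L1\<close> norms is integrable against a
  probability measure. Each exchange of a mean with a Lebesgue integral below is justified in this
  way.\<close>

lemma integrable_pair_uniform_bound:
  fixes f :: "'a \<times> 'b \<Rightarrow> real"
  assumes "prob_space N" "sigma_finite_measure L"
    and [measurable]: "f \<in> borel_measurable (N \<Otimes>\<^sub>M L)"
    and int: "\<And>p. p \<in> space N \<Longrightarrow> integrable L (\<lambda>z. f (p, z))"
    and bd: "\<And>p. p \<in> space N \<Longrightarrow> (\<integral>z. \<bar>f (p, z)\<bar> \<partial>L) \<le> c"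
  shows "integrable (N \<Otimes>\<^sub>M L) f"
proof -
  interpret N: prob_space N by fact
  interpret L: sigma_finite_measure L by fact
  interpret pair_sigma_finite N L ..
  show ?thesis
  proof (rule Fubini_integrable)
    show "integrable N (\<lambda>p. \<integral>z. norm (f (p, z)) \<partial>L)"
      by (rule N.integrable_const_bound[where B=c]) (use bd in \<open>auto intro!: AE_I2\<close>)
  qed (use int in auto)
qed

section \<open>Kernel energies of \<open>P - Q\<close>\<close>

text \<open>
  The energy of \<open>P - Q\<close> under a kernel \<open>F\<close> is the mean of \<open>cross_diff F p q\<close> for independent
  \<open>p\<close>, \<open>q\<close> distributed as \<open>P \<Otimes>\<^sub>M Q\<close>; this avoids signed measures.
\<close>

definition cross_diff :: "('a \<Rightarrow> 'a \<Rightarrow> real) \<Rightarrow> 'a \<times> 'a \<Rightarrow> 'a \<times> 'a \<Rightarrow> real" where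
  "cross_diff F p q = F (fst p) (fst q) - F (snd p) (fst q) - (F (fst p) (snd q) - F (snd p) (snd q))"

lemma has_bochner_integral_cross_diff:
  assumes "\<And>x y. has_bochner_integral L (\<lambda>z. F z x y) (I x y)"
  shows "has_bochner_integral L (\<lambda>z. cross_diff (F z) p q) (cross_diff I p q)"
  unfolding cross_diff_def by (intro has_bochner_integral_diff assms)

text \<open>Substitution \<open>z = x + u *\<^sub>R v\<close>. The value does not depend on the
  centre \<open>x\<close>, which makes the later bounds for Fubini uniform.\<close>

lemma gauss_shift:
  fixes x :: "'a::euclidean_space"
  assumes u: "0 < u" and c: "0 < c"
  shows "has_bochner_integral lborel (\<lambda>z. exp (- c * (norm (x - z) / u)\<^sup>2))
           (u ^ DIM('a) * (\<integral>v. exp (- c * (norm (v::'a))\<^sup>2) \<partial>lborel))"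
proof -
  have u0: "u \<noteq> 0" using u by simp
  have [simp]: "norm (x - (x + u *\<^sub>R v)) / u = norm v" for v using u by simp
  have m: "(\<lambda>z. exp (- c * (norm (x - z) / u)\<^sup>2)) \<in> borel_measurable borel" by measurable
  show ?thesis
    unfolding has_bochner_integral_iff lborel_integral_affine(1)[OF m u0, of x] lborel_integral_affine(2)[OF m u0, of x]
    using integrable_gauss(1)[OF c, where 'a='a] u by simp
qed

text \<open>The Gaussian kernel becomes, up to a positive constant, an \<open>L2\<close> inner
  product of Gaussians centred at \<open>x\<close> and \<open>y\<close>. The exponent 2 is the one
  whose overlap has exponent 1.\<close>

lemma gauss_overlap:
  fixes x y :: "'a::euclidean_space"
  assumes u: "0 < u"
  shows "has_bochner_integral lborel
           (\<lambda>z. exp (- 2 * (norm (x - z) / u)\<^sup>2) * exp (- 2 * (norm (y - z) / u)\<^sup>2))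
           (u ^ DIM('a) * (\<integral>v. exp (- 4 * (norm (v::'a))\<^sup>2) \<partial>lborel) * exp (- (norm (x - y) / u)\<^sup>2))"
proof -
  \<comment> \<open>Parallelogram law around the midpoint of \<open>x\<close> and \<open>y\<close>.\<close>
  have eq: "exp (- 2 * (norm (x - z) / u)\<^sup>2) * exp (- 2 * (norm (y - z) / u)\<^sup>2)
      = exp (- 4 * (norm ((1/2) *\<^sub>R (x + y) - z) / u)\<^sup>2) * exp (- (norm (x - y) / u)\<^sup>2)" for z
  proof -
    have "2 * (norm (x - z))\<^sup>2 + 2 * (norm (y - z))\<^sup>2 = 4 * (norm ((1/2) *\<^sub>R (x + y) - z))\<^sup>2 + (norm (x - y))\<^sup>2"
      unfolding power2_norm_eq_inner by (simp add: inner_simps inner_commute algebra_simps)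
    then have "(2 * (norm (x - z))\<^sup>2 + 2 * (norm (y - z))\<^sup>2) / u\<^sup>2 = (4 * (norm ((1/2) *\<^sub>R (x + y) - z))\<^sup>2 + (norm (x - y))\<^sup>2) / u\<^sup>2"
      by simp
    then show ?thesis by (simp add: exp_add[symmetric] power_divide add_divide_distrib)
  qed
  show ?thesis
    unfolding eq by (intro has_bochner_integral_mult_left gauss_shift u) simp_all
qed

text \<open>A rank-one kernel splits into the same function of \<open>p\<close> and of
  \<open>q\<close>, so that its mean over independent copies is a square.\<close>

lemma cross_diff_product:
  "cross_diff (\<lambda>x y. h x * h y) p q = (h (fst p) - h (snd p)) * (h (fst q) - h (snd q))"
  by (simp add: cross_diff_def algebra_simps)

lemma cross_diff_scale: "cross_diff (\<lambda>x y. c * F x y) p q = c * cross_diff F p q"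
  by (simp add: cross_diff_def algebra_simps)

text \<open>Two of the four values enter with each sign; nonnegativity therefore gives
  \<open>2 * c\<close> instead of \<open>4 * c\<close>.\<close>

lemma cross_diff_bound:
  assumes "\<And>x y. 0 \<le> F x y" "\<And>x y. F x y \<le> c"
  shows "\<bar>cross_diff F p q\<bar> \<le> 2 * c"
  using assms(1)[of "fst p" "fst q"] assms(1)[of "snd p" "fst q"] assms(1)[of "fst p" "snd q"] assms(1)[of "snd p" "snd q"]
    assms(2)[of "fst p" "fst q"] assms(2)[of "snd p" "fst q"] assms(2)[of "fst p" "snd q"] assms(2)[of "snd p" "snd q"]
  unfolding cross_diff_def by linarith

lemma (in pair_prob_space) distr_pair_snd: "distr (M1 \<Otimes>\<^sub>M M2) M2 snd = M2"
  proof -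
    have "distr (M1 \<Otimes>\<^sub>M M2) M2 snd = distr (M2 \<Otimes>\<^sub>M M1) M2 (snd \<circ> (\<lambda>(x, y). (y, x)))"
      by (subst distr_pair_swap, subst distr_distr) auto
    also have "snd \<circ> (\<lambda>(x, y). (y, x)) = (fst :: 'b \<times> 'a \<Rightarrow> 'b)" by auto
    finally show ?thesis by (simp add: M1.distr_pair_fst)
  qed

lemma (in pair_prob_space) integral_diff_pair:
  fixes f :: "'a \<Rightarrow> real" 
  assumes "integrable M1 f" "integrable M2 g"
  shows "(\<integral>p. f (fst p) - g (snd p) \<partial>(M1 \<Otimes>\<^sub>M M2)) = (\<integral>x. f x \<partial>M1) - (\<integral>x. g x \<partial>M2)"
    and "integrable (M1 \<Otimes>\<^sub>M M2) (\<lambda>p. f (fst p) - g (snd p))"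
proof -
  note m1 = M2.distr_pair_fst[of M1]
  note m2 = distr_pair_snd
  have i1: "has_bochner_integral (M1 \<Otimes>\<^sub>M M2) (\<lambda>p. f (fst p)) (\<integral>x. f x \<partial>M1)"
    using assms(1) integrable_distr_eq[of fst "M1 \<Otimes>\<^sub>M M2" M1 f] integral_distr[of fst "M1 \<Otimes>\<^sub>M M2" M1 f]
    by (simp add: m1 has_bochner_integral_iff)
  have i2: "has_bochner_integral (M1 \<Otimes>\<^sub>M M2) (\<lambda>p. g (snd p)) (\<integral>x. g x \<partial>M2)"
    using assms(2) integrable_distr_eq[of snd "M1 \<Otimes>\<^sub>M M2" M2 g] integral_distr[of snd "M1 \<Otimes>\<^sub>M M2" M2 g]
    by (simp add: m2 has_bochner_integral_iff)
  from has_bochner_integral_diff[OF i1 i2]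
  show "(\<integral>p. f (fst p) - g (snd p) \<partial>(M1 \<Otimes>\<^sub>M M2)) = (\<integral>x. f x \<partial>M1) - (\<integral>x. g x \<partial>M2)"
    and "integrable (M1 \<Otimes>\<^sub>M M2) (\<lambda>p. f (fst p) - g (snd p))"
    by (simp_all add: has_bochner_integral_iff)
qed

text \<open>Inserting the overlap formula and exchanging integrals turns the energy, up to a
  positive factor, into the squared \<open>L2\<close> norm of the difference of the two
  smoothings.\<close>

lemma gauss_energy:
  fixes P Q :: "'a::euclidean_space measure"
  assumes "prob_space P" "prob_space Q" and [measurable_cong]: "sets P = sets borel" "sets Q = sets borel"
    and u: "0 < u"
  defines "J \<equiv> \<integral>p. cross_diff (\<lambda>x y. exp (- (norm (x - y) / u)\<^sup>2)) (fst p) (snd p) \<partial>((P \<Otimes>\<^sub>M Q) \<Otimes>\<^sub>M (P \<Otimes>\<^sub>M Q))"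
  shows "0 \<le> J"
    and "J = 0 \<Longrightarrow> AE z in lborel. (\<integral>x. exp (- 2 * (norm (x - z) / u)\<^sup>2) \<partial>P) = (\<integral>x. exp (- 2 * (norm (x - z) / u)\<^sup>2) \<partial>Q)"
proof -
  interpret P: prob_space P by fact
  interpret Q: prob_space Q by fact
  interpret PQ: pair_prob_space P Q ..
  let ?M = "P \<Otimes>\<^sub>M Q" let ?N = "?M \<Otimes>\<^sub>M ?M"
  interpret M: prob_space ?M by (intro prob_space_pair) fact+
  interpret N: prob_space ?N by (intro prob_space_pair) unfold_locales
  interpret MM: pair_prob_space ?M ?M ..
  interpret NL: pair_sigma_finite ?N lborel ..
  define h where "h z x = exp (- 2 * (norm (x - z) / u)\<^sup>2)" for x z :: 'a
  define \<psi> where "\<psi> z p = h z (fst p) - h z (snd p)" for z p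
  define D where "D = u ^ DIM('a) * (\<integral>v. exp (- 4 * (norm (v::'a))\<^sup>2) \<partial>lborel)"
  have "0 < D" unfolding D_def using u integrable_gauss(2)[where c=4 and 'a='a] by simp
  have h01: "0 \<le> h z x" "h z x \<le> 1" for z x by (auto simp: h_def)
  have [measurable]: "h z \<in> borel_measurable borel" for z
    unfolding h_def by measurable
  have h_int: "integrable lborel (\<lambda>z. h z x)" and h_eq: "(\<integral>z. h z x \<partial>lborel) = (\<integral>z. h z 0 \<partial>lborel)" for x
    using gauss_shift[OF u, of 2 x] gauss_shift[OF u, of 2 "0::'a"] by (auto simp: h_def has_bochner_integral_iff)
  have \<psi>1: "\<bar>\<psi> z p\<bar> \<le> 1" for z p using h01[of z] unfolding \<psi>_def by (smt (verit))
  have \<psi>_int: "(\<integral>p. \<psi> z p \<partial>?M) = (\<integral>x. h z x \<partial>P) - (\<integral>x. h z x \<partial>Q)" for z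
    unfolding \<psi>_def
    by (rule PQ.integral_diff_pair) (use h01 in \<open>auto intro!: P.integrable_const_bound[where B=1] Q.integrable_const_bound[where B=1]\<close>)
  \<comment> \<open>Independence of the two components under \<open>?N\<close> produces the
    square.\<close>
  have prod_int: "(\<integral>p. \<psi> z (fst p) * \<psi> z (snd p) \<partial>?N) = (\<integral>p. \<psi> z p \<partial>?M)\<^sup>2" for z
  proof -
    have "integrable ?N (\<lambda>(p, q). \<psi> z p * \<psi> z q)"
      by (rule N.integrable_const_bound[where B=1])
         (use mult_mono[OF \<psi>1 \<psi>1] in \<open>auto simp: abs_mult \<psi>_def[abs_def] split_beta'\<close>)
    from MM.integral_fst[OF this] show ?thesis
      by (simp add: split_beta' power2_eq_square)
  qed
  have J: "has_bochner_integral lborel (\<lambda>z. \<psi> z p * \<psi> z q) (D * cross_diff (\<lambda>x y. exp (- (norm (x - y) / u)\<^sup>2)) p q)" for p q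
    unfolding cross_diff_scale[symmetric] \<psi>_def cross_diff_product[symmetric]
    by (rule has_bochner_integral_cross_diff) (unfold h_def D_def, rule gauss_overlap[OF u])
  \<comment> \<open>One factor \<open>\<psi>\<close> is bounded by 1 and the other by the sum of two
    Gaussians in \<open>z\<close>, each with the integral of \<open>h z 0\<close>.\<close>
  define c where "c = 2 * (\<integral>z. h z 0 \<partial>lborel)"
  have int: "integrable (?N \<Otimes>\<^sub>M lborel) (\<lambda>(p, z). \<psi> z (fst p) * \<psi> z (snd p))"
  proof (rule integrable_pair_uniform_bound[where c=c])
    show "prob_space ?N" "sigma_finite_measure lborel" by unfold_locales
    show "(\<lambda>(p, z). \<psi> z (fst p) * \<psi> z (snd p)) \<in> borel_measurable (?N \<Otimes>\<^sub>M lborel)"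
      unfolding \<psi>_def h_def by measurable
    fix p
    show i: "integrable lborel (\<lambda>z. case (p, z) of (p, z) \<Rightarrow> \<psi> z (fst p) * \<psi> z (snd p))"
      using J[of "fst p" "snd p"] by (simp add: has_bochner_integral_iff)
    have "\<bar>\<psi> z (fst p) * \<psi> z (snd p)\<bar> \<le> h z (fst (fst p)) + h z (snd (fst p))" for z
    proof -
      have "\<bar>\<psi> z (fst p) * \<psi> z (snd p)\<bar> \<le> \<bar>\<psi> z (fst p)\<bar> * 1"
        unfolding abs_mult by (intro mult_left_mono \<psi>1) simp
      also have "\<dots> \<le> h z (fst (fst p)) + h z (snd (fst p))"
        using h01(1)[of z "fst (fst p)"] h01(1)[of z "snd (fst p)"] by (simp add: \<psi>_def)
      finally show ?thesis .
    qed
    then have "(\<integral>z. \<bar>\<psi> z (fst p) * \<psi> z (snd p)\<bar> \<partial>lborel) \<le> (\<integral>z. h z (fst (fst p)) + h z (snd (fst p)) \<partial>lborel)"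
      using i by (intro integral_mono) (auto intro: h_int)
    also have "\<dots> = c" by (simp add: h_int h_eq[of "fst (fst p)"] h_eq[of "snd (fst p)"] c_def)
    finally show "(\<integral>z. \<bar>case (p, z) of (p, z) \<Rightarrow> \<psi> z (fst p) * \<psi> z (snd p)\<bar> \<partial>lborel) \<le> c" by simp
  qed
  have sq: "D * J = (\<integral>z. (\<integral>p. \<psi> z p \<partial>?M)\<^sup>2 \<partial>lborel)"
    using NL.Fubini_integral[OF int] J by (simp add: prod_int J_def has_bochner_integral_iff)
  then have "0 \<le> D * J" by simp
  with \<open>0 < D\<close> show "0 \<le> J" by (simp add: zero_le_mult_iff)
  assume "J = 0"
  have "integrable lborel (\<lambda>z. (\<integral>p. \<psi> z p \<partial>?M)\<^sup>2)"
    using NL.integrable_snd[OF int] by (simp add: prod_int)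
  from integral_nonneg_eq_0_iff_AE[OF this] sq \<open>J = 0\<close>
  have "AE z in lborel. (\<integral>p. \<psi> z p \<partial>?M) = 0" by simp
  then show "AE z in lborel. (\<integral>x. exp (- 2 * (norm (x - z) / u)\<^sup>2) \<partial>P) = (\<integral>x. exp (- 2 * (norm (x - z) / u)\<^sup>2) \<partial>Q)"
    by (simp add: \<psi>_int h_def)
qed

text \<open>The energy of the exponential kernel vanishes and is an average, with positive weights,
  of the nonnegative Gaussian energies over \<open>u > 0\<close>. Almost all of these vanish, hence
  one does below any given \<open>e\<close>.\<close>

lemma exp_kernel_embedding_zero:
  fixes P Q :: "'a::euclidean_space measure"
  assumes "prob_space P" "prob_space Q" and [measurable_cong]: "sets P = sets borel" "sets Q = sets borel"
    and a: "0 < a" and S: "AE x in P. x \<in> S" "AE x in Q. x \<in> S"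
    and eq: "\<And>w. w \<in> S \<Longrightarrow> (\<integral>x. exp (- 2 * a * norm (x - w)) \<partial>P) = (\<integral>x. exp (- 2 * a * norm (x - w)) \<partial>Q)"
    and e: "0 < e"
  shows "\<exists>u. 0 < u \<and> u < e \<and>
    (AE z in lborel. (\<integral>x. exp (- 2 * (norm (x - z) / u)\<^sup>2) \<partial>P) = (\<integral>x. exp (- 2 * (norm (x - z) / u)\<^sup>2) \<partial>Q))"
proof -
  interpret P: prob_space P by fact
  interpret Q: prob_space Q by fact
  interpret PQ: pair_prob_space P Q ..
  let ?M = "P \<Otimes>\<^sub>M Q" let ?N = "?M \<Otimes>\<^sub>M ?M"
  interpret M: prob_space ?M by (intro prob_space_pair) fact+
  interpret N: prob_space ?N by (intro prob_space_pair) unfold_locales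
  interpret MM: pair_prob_space ?M ?M ..
  interpret NL: pair_sigma_finite ?N lborel ..
  define k where "k x y = exp (- 2 * a * norm (x - y))" for x y :: 'a
  \<comment> \<open>The Gaussian kernel together with its mixing weight; the indicator allows
    integration over the whole real line.\<close>
  define G where "G u x y = indicator {0<..} u * exp (- (a * u)\<^sup>2 - (norm (x - y) / u)\<^sup>2)" for u and x y :: 'a
  define c where "c = sqrt pi / (2 * a)"
  have k01: "0 \<le> k x y" "k x y \<le> 1" for x y using a by (auto simp: k_def)
  have [measurable]: "(\<lambda>x. k x y) \<in> borel_measurable borel" for y unfolding k_def by measurable
  have ki: "integrable P (\<lambda>x. k x y)" "integrable Q (\<lambda>x. k x y)" for y
    using k01 by (auto intro!: P.integrable_const_bound[where B=1] Q.integrable_const_bound[where B=1])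
  have mix: "has_bochner_integral lborel (\<lambda>u. cross_diff (G u) p q) (c * cross_diff k p q)" for p q
    unfolding cross_diff_scale[symmetric]
    by (rule has_bochner_integral_cross_diff) (unfold G_def c_def k_def, rule exp_gauss_mixture, use a in auto)
  \<comment> \<open>\<open>S\<close> is not assumed measurable. A null set of a marginal pulls back
    to a null set of the product, which suffices.\<close>
  have AEq: "AE q in ?M. fst q \<in> S \<and> snd q \<in> S"
  proof -
    have "AE x in distr ?M P fst. x \<in> S" "AE x in distr ?M Q snd. x \<in> S"
      unfolding PQ.distr_pair_snd Q.distr_pair_fst by fact+
    then have "AE q in ?M. fst q \<in> S" "AE q in ?M. snd q \<in> S"
      by (auto dest: AE_distrD[rotated])
    then show ?thesis by auto
  qed
  \<comment> \<open>For fixed \<open>q\<close> the mean over \<open>p\<close> is the difference of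
    the kernel means of \<open>P\<close> and \<open>Q\<close> at \<open>fst q\<close>, minus the
    same difference at \<open>snd q\<close>.\<close>
  have zero: "(\<integral>p. cross_diff k p q \<partial>?M) = 0" if "fst q \<in> S" "snd q \<in> S" for q
  proof -
    have diff: "has_bochner_integral ?M (\<lambda>p. k (fst p) w - k (snd p) w) ((\<integral>x. k x w \<partial>P) - (\<integral>x. k x w \<partial>Q))" for w
      using PQ.integral_diff_pair[OF ki(1)[of w] ki(2)[of w]] by (simp add: has_bochner_integral_iff)
    have diff0: "has_bochner_integral ?M (\<lambda>p. k (fst p) w - k (snd p) w) 0" if "w \<in> S" for w
      using diff[of w] eq[OF that, folded k_def] by simp
    from has_bochner_integral_diff[OF diff0[OF that(1)] diff0[OF that(2)]] show ?thesis
      unfolding cross_diff_def by (simp add: has_bochner_integral_iff)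
  qed
  have "integrable ?N (\<lambda>(p, q). cross_diff k p q)"
  proof (rule N.integrable_const_bound[where B=2])
    show "(\<lambda>(p, q). cross_diff k p q) \<in> borel_measurable ?N"
      unfolding cross_diff_def k_def by measurable
  qed (use cross_diff_bound[of k 1] k01 in auto)
  from MM.integral_snd[OF this]
  have "(\<integral>p. cross_diff k (fst p) (snd p) \<partial>?N) = (\<integral>q. (\<integral>p. cross_diff k p q \<partial>?M) \<partial>?M)"
    by (simp add: split_beta')
  also have "\<dots> = 0"
    using AEq zero by (intro integral_eq_zero_AE) auto
  finally have k0: "(\<integral>p. cross_diff k (fst p) (snd p) \<partial>?N) = 0" .
  define g where "g u = (\<integral>p. cross_diff (G u) (fst p) (snd p) \<partial>?N)" for u
  have mix0: "has_bochner_integral lborel (\<lambda>u. indicator {0<..} u * exp (- (a * u)\<^sup>2)) c"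
    using exp_gauss_mixture[OF a, of 0] by (simp add: c_def)
  have int: "integrable (?N \<Otimes>\<^sub>M lborel) (\<lambda>(p, u). cross_diff (G u) (fst p) (snd p))"
  proof (rule integrable_pair_uniform_bound[where c="2 * c"])
    show "prob_space ?N" "sigma_finite_measure lborel" by unfold_locales
    show "(\<lambda>(p, u). cross_diff (G u) (fst p) (snd p)) \<in> borel_measurable (?N \<Otimes>\<^sub>M lborel)"
      unfolding cross_diff_def G_def by measurable
    fix p
    show i: "integrable lborel (\<lambda>u. case (p, u) of (p, u) \<Rightarrow> cross_diff (G u) (fst p) (snd p))"
      using mix[of "fst p" "snd p"] by (simp add: has_bochner_integral_iff)
    \<comment> \<open>The dominating function is twice the mixture integrand at distance 0, whose
      integral is \<open>c\<close>.\<close>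
    have "\<bar>cross_diff (G u) (fst p) (snd p)\<bar> \<le> 2 * (indicator {0<..} u * exp (- (a * u)\<^sup>2))" for u
      by (rule cross_diff_bound) (auto simp: G_def split: split_indicator)
    then have "(\<integral>u. \<bar>cross_diff (G u) (fst p) (snd p)\<bar> \<partial>lborel) \<le> (\<integral>u. 2 * (indicator {0<..} u * exp (- (a * u)\<^sup>2)) \<partial>lborel)"
      using i mix0 by (intro integral_mono) (auto simp: has_bochner_integral_iff)
    also have "\<dots> = 2 * c" using mix0 by (simp add: has_bochner_integral_iff)
    finally show "(\<integral>u. \<bar>case (p, u) of (p, u) \<Rightarrow> cross_diff (G u) (fst p) (snd p)\<bar> \<partial>lborel) \<le> 2 * c" by simp
  qed
  have gi: "integrable lborel g" unfolding g_def
    using NL.integrable_snd[OF int] by simp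
  \<comment> \<open>Integrating over \<open>u\<close> first gives \<open>c\<close> times the energy
    of the exponential kernel, which is 0 by \<open>k0\<close>.\<close>
  have g0: "(\<integral>u. g u \<partial>lborel) = 0" unfolding g_def
    using NL.Fubini_integral[OF int] mix k0 by (simp add: has_bochner_integral_iff)
  define J where "J u = (\<integral>p. cross_diff (\<lambda>x y. exp (- (norm (x - y) / u)\<^sup>2)) (fst p) (snd p) \<partial>?N)" for u
  have gJ: "g u = (if 0 < u then exp (- (a * u)\<^sup>2) * J u else 0)" for u
  proof -
    have "G u = (\<lambda>x y. (indicator {0<..} u * exp (- (a * u)\<^sup>2)) * exp (- (norm (x - y) / u)\<^sup>2))"
      by (intro ext) (simp add: G_def exp_diff exp_minus divide_inverse)
    then show ?thesis unfolding g_def J_def by (simp add: cross_diff_scale)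
  qed
  note J = gauss_energy[OF assms(1-4), folded J_def]
  have "g u \<ge> 0" for u using J(1) by (simp add: gJ)
  then have AEg: "AE u in lborel. g u = 0"
    using integral_nonneg_eq_0_iff_AE[OF gi] g0 by simp
  \<comment> \<open>Otherwise the interval from 0 to \<open>e\<close>, of positive length, would be
    a null set.\<close>
  have "\<exists>u. 0 < u \<and> u < e \<and> g u = 0"
  proof (rule ccontr)
    assume "\<not> (\<exists>u. 0 < u \<and> u < e \<and> g u = 0)"
    with AEg have "AE u in lborel. u \<notin> {0<..<e}" by (auto elim: eventually_mono)
    then have "emeasure lborel {0<..<e} = 0"
      by (subst (asm) AE_iff_measurable[where N="{0<..<e}"]) auto
    with e show False by simp
  qed
  then show ?thesis using J(2) by (auto simp: gJ)
qed

section \<open>Recovering a measure from its Gaussian smoothings\<close>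

text \<open>Smoothing moves from the measure to the test function by Fubini. After the substitution
  \<open>z = x + u *\<^sub>R v\<close> the width occurs only in the prefactor and in the argument of
  \<open>f\<close>, so that a limit in \<open>u\<close> can be taken.\<close>

lemma gauss_smoothing_integral:
  fixes P :: "'a::euclidean_space measure" and f :: "'a \<Rightarrow> real"
  assumes "prob_space P" and [measurable_cong]: "sets P = sets borel"
    and [measurable]: "f \<in> borel_measurable borel" and f: "\<And>x. \<bar>f x\<bar> \<le> 1" and u: "0 < u"
  shows "(\<integral>z. f z * (\<integral>x. exp (- 2 * (norm (x - z) / u)\<^sup>2) \<partial>P) \<partial>lborel)
    = u ^ DIM('a) * (\<integral>x. (\<integral>v. f (x + u *\<^sub>R v) * exp (- 2 * (norm v)\<^sup>2) \<partial>lborel) \<partial>P)"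
proof -
  interpret P: prob_space P by fact
  interpret PL: pair_sigma_finite P lborel ..
  let ?h = "\<lambda>x z. exp (- 2 * (norm (x - z) / u)\<^sup>2)"
  note h = gauss_shift[where 'a='a, OF u, of 2, unfolded has_bochner_integral_iff]
  have bd: "\<bar>f z * ?h x z\<bar> \<le> ?h x z" for x z
    using f[of z] by (simp add: abs_mult)
  have i: "integrable lborel (\<lambda>z. f z * ?h x z)" for x
    by (rule Bochner_Integration.integrable_bound[where f="?h x"]) (use h bd in auto)
  have int: "integrable (P \<Otimes>\<^sub>M lborel) (\<lambda>(x, z). f z * ?h x z)"
  proof (rule integrable_pair_uniform_bound[where c="u ^ DIM('a) * (\<integral>v. exp (- 2 * (norm (v::'a))\<^sup>2) \<partial>lborel)"])
    show "prob_space P" "sigma_finite_measure lborel" by unfold_locales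
    fix x
    show "integrable lborel (\<lambda>z. case (x, z) of (x, z) \<Rightarrow> f z * ?h x z)" using i by simp
    have "(\<integral>z. \<bar>f z * ?h x z\<bar> \<partial>lborel) \<le> (\<integral>z. ?h x z \<partial>lborel)"
      using i h bd by (intro integral_mono integrable_abs) auto
    with h show "(\<integral>z. \<bar>case (x, z) of (x, z) \<Rightarrow> f z * ?h x z\<bar> \<partial>lborel) \<le> u ^ DIM('a) * (\<integral>v. exp (- 2 * (norm (v::'a))\<^sup>2) \<partial>lborel)"
      by simp
  qed measurable
  have "(\<integral>z. f z * ?h x z \<partial>lborel) = u ^ DIM('a) * (\<integral>v. f (x + u *\<^sub>R v) * exp (- 2 * (norm v)\<^sup>2) \<partial>lborel)" for x
    using u by (subst lborel_integral_affine(1)[of _ u x]) auto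
  with PL.Fubini_integral[OF int] show ?thesis by simp
qed

text \<open>Dominated convergence is applied twice: inside with the Gaussian as bound, using
  continuity of \<open>f\<close>, and outside with the Gaussian mass as a constant bound.\<close>

lemma gauss_smoothing_tendsto:
  fixes P :: "'a::euclidean_space measure" and f :: "'a \<Rightarrow> real"
  assumes "prob_space P" and [measurable_cong]: "sets P = sets borel"
    and cont: "continuous_on UNIV f" and f: "\<And>x. \<bar>f x\<bar> \<le> 1" and u: "u \<longlonglongrightarrow> 0"
  shows "(\<lambda>n. \<integral>x. (\<integral>v. f (x + u n *\<^sub>R v) * exp (- 2 * (norm v)\<^sup>2) \<partial>lborel) \<partial>P)
    \<longlonglongrightarrow> (\<integral>x. f x \<partial>P) * (\<integral>v. exp (- 2 * (norm (v::'a))\<^sup>2) \<partial>lborel)"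
proof -
  interpret P: prob_space P by fact
  have [measurable]: "f \<in> borel_measurable borel" by (rule borel_measurable_continuous_onI[OF cont])
  let ?e = "\<lambda>v::'a. exp (- 2 * (norm v)\<^sup>2)"
  have e: "integrable lborel ?e" by (rule integrable_gauss) simp
  have bd: "\<bar>f y * ?e v\<bar> \<le> ?e v" for y v
    using f[of y] by (simp add: abs_mult)
  have i: "integrable lborel (\<lambda>v. f (x + t *\<^sub>R v) * ?e v)" for x t
    by (rule Bochner_Integration.integrable_bound[OF e]) (use bd in auto)
  have "(\<lambda>n. \<integral>x. (\<integral>v. f (x + u n *\<^sub>R v) * ?e v \<partial>lborel) \<partial>P) \<longlonglongrightarrow> (\<integral>x. (\<integral>v. f x * ?e v \<partial>lborel) \<partial>P)"
  proof (rule integral_dominated_convergence[where w="\<lambda>_. \<integral>v. ?e v \<partial>lborel"])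
    show "AE x in P. (\<lambda>n. \<integral>v. f (x + u n *\<^sub>R v) * ?e v \<partial>lborel) \<longlonglongrightarrow> (\<integral>v. f x * ?e v \<partial>lborel)"
    proof (intro AE_I2 integral_dominated_convergence[where w="?e"])
      fix x v
      have "(\<lambda>n. f (x + u n *\<^sub>R v)) \<longlonglongrightarrow> f (x + 0 *\<^sub>R v)"
        using cont by (intro isCont_tendsto_compose[where g=f] tendsto_intros u) (simp add: continuous_on_eq_continuous_at)
      then show "(\<lambda>n. f (x + u n *\<^sub>R v) * ?e v) \<longlonglongrightarrow> f x * ?e v"
        by (intro tendsto_intros) simp
    qed (use e bd in auto)
    show "AE x in P. norm (\<integral>v. f (x + u n *\<^sub>R v) * ?e v \<partial>lborel) \<le> (\<integral>v. ?e v \<partial>lborel)" for n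
    proof (intro AE_I2)
      fix x
      have "norm (\<integral>v. f (x + u n *\<^sub>R v) * ?e v \<partial>lborel) \<le> (\<integral>v. \<bar>f (x + u n *\<^sub>R v) * ?e v\<bar> \<partial>lborel)"
        by (simp add: integral_abs_bound)
      also have "\<dots> \<le> (\<integral>v. ?e v \<partial>lborel)"
        using i e bd by (intro integral_mono integrable_abs) auto
      finally show "norm (\<integral>v. f (x + u n *\<^sub>R v) * ?e v \<partial>lborel) \<le> (\<integral>v. ?e v \<partial>lborel)" .
    qed
  qed auto
  then show ?thesis by simp
qed

text \<open>Brings equality back from the whole space, where smoothing takes place, to
  \<open>Z\<close>. As \<open>Z\<close> is Borel, its measurable subsets are Borel in the whole
  space and keep their mass under the inclusion.\<close>

lemma distr_restrict_space_borel_inject: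
  fixes P Q :: "'a::topological_space measure"
  assumes Z: "Z \<in> sets borel"
    and P: "sets P = sets (restrict_space borel Z)" and Q: "sets Q = sets (restrict_space borel Z)"
    and eq: "distr P borel (\<lambda>x. x) = distr Q borel (\<lambda>x. x)"
  shows "P = Q"
proof (rule measure_eqI)
  show "sets P = sets Q" using P Q by simp
  fix A assume A: "A \<in> sets P"
  have "emeasure M A = emeasure (distr M borel (\<lambda>x. x)) A" if M: "sets M = sets (restrict_space borel Z)" for M
  proof -
    have "A \<in> sets borel" "A \<subseteq> Z"
      using A Z by (auto simp: P sets_restrict_space)
    moreover have "(\<lambda>x. x) \<in> measurable M borel"
      using measurable_restrict_space1[of "\<lambda>x. x" borel borel Z] measurable_cong_sets[OF M refl] by auto
    moreover have "space M = Z"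
      using sets_eq_imp_space_eq[OF M] by (simp add: space_restrict_space)
    ultimately show ?thesis by (simp add: emeasure_distr Int_absorb2)
  qed
  with P Q eq show "emeasure P A = emeasure Q A" by metis
qed

section \<open>The unit ball of the reproducing kernel Hilbert space\<close>

context rkhs
begin

lemma eval_sq_le:
  assumes f: "f \<in> H" and w: "w \<in> X" and K: "K w w = 1"
  shows "(f w)\<^sup>2 \<le> ip f f"
proof -
  let ?k = "kernel_section X K w"
  \<comment> \<open>Cauchy--Schwarz: \<open>f - f(w) K(\<cdot>,w)\<close> is the component of \<open>f\<close> orthogonal to the unit vector \<open>K(\<cdot>,w)\<close>.\<close>
  define s where "s = - f w"
  have k: "?k \<in> H" "(\<lambda>x. s * ?k x) \<in> H" using section_mem[OF w] scale_mem by auto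
  let ?g = "\<lambda>x. f x + s * ?k x"
  have g: "?g \<in> H" using add_mem[OF f k(2)] .
  have kk: "ip ?k ?k = 1" using reproducing[OF k(1) w] w K by (simp add: kernel_section_def)
  have fk: "ip f ?k = f w" using reproducing[OF f w] by simp
  have gk: "ip ?g ?k = 0"
    using ip_add_left[OF f k(2) k(1)] ip_scale_left[OF k(1) k(1), of s] kk fk by (simp add: s_def)
  have "ip ?g ?g = ip ?g f + s * ip ?g ?k"
    using ip_commute[OF g f] ip_add_left[OF f k(2) g] ip_scale_left[OF k(1) g, of s] ip_commute[OF k(1) g] by simp
  also have "ip ?g f = ip f f + s * f w"
    using ip_add_left[OF f k(2) f] ip_scale_left[OF k(1) f, of s] ip_commute[OF k(1) f] fk by simp
  finally have "ip ?g ?g = ip f f - (f w)\<^sup>2" using gk by (simp add: s_def power2_eq_square)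
  with ip_nonneg[OF g] show ?thesis by simp
qed

text \<open>Keeps all mean gaps over the unit ball bounded, so that the supremum in
  \<open>mmd\<close> is a genuine one.\<close>

lemma unit_ball_bound:
  assumes f: "f \<in> H" "ip_norm ip f \<le> 1" and K: "\<And>w. w \<in> X \<Longrightarrow> K w w = 1"
  shows "\<bar>f x\<bar> \<le> 1"
proof (cases "x \<in> X")
  case True
  have "(f x)\<^sup>2 \<le> ip f f" by (rule eval_sq_le[OF f(1) True K[OF True]])
  also have "\<dots> \<le> 1" using f(2) by (simp add: ip_norm_def)
  finally show ?thesis by (simp add: abs_square_le_1)
qed (use zero_outside[OF f(1)] in simp)

lemma section_norm:
  assumes "w \<in> X" "K w w = 1"
  shows "ip_norm ip (kernel_section X K w) = 1"
  using reproducing[OF section_mem[OF assms(1)] assms(1)] assms by (simp add: ip_norm_def kernel_section_def)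

end

text \<open>A function that is not integrable has integral 0 by convention, so the pointwise bound
  settles that case too.\<close>

lemma (in prob_space) abs_integral_le_1:
  fixes f :: "'a \<Rightarrow> real"
  assumes "\<And>x. \<bar>f x\<bar> \<le> 1"
  shows "\<bar>\<integral>x. f x \<partial>M\<bar> \<le> 1"
proof (cases "integrable M f")
  case True
  have "\<bar>\<integral>x. f x \<partial>M\<bar> \<le> (\<integral>x. \<bar>f x\<bar> \<partial>M)" by (rule integral_abs_bound)
  also have "\<dots> \<le> 1" using True assms by (intro integral_le_const) auto
  finally show ?thesis .
qed (simp add: not_integrable_integral_eq)

text \<open>A real-valued \<open>SUP\<close> dominates its members only for a family bounded above;
  here each gap is a difference of two numbers of modulus at most 1.\<close>

lemma (in rkhs) mean_gap_le_mmd: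
  assumes "prob_space P" "prob_space Q" and K: "\<And>w. w \<in> X \<Longrightarrow> K w w = 1"
    and f: "f \<in> H" "ip_norm ip f \<le> 1"
  shows "mean_gap P Q f \<le> mmd H ip P Q"
  unfolding mmd_def
proof (rule cSUP_upper)
  show "bdd_above (mean_gap P Q ` {f \<in> H. ip_norm ip f \<le> 1})"
  proof (rule bdd_aboveI2)
    fix g assume "g \<in> {f \<in> H. ip_norm ip f \<le> 1}"
    then have "\<bar>g x\<bar> \<le> 1" for x using unit_ball_bound K by blast
    then show "mean_gap P Q g \<le> 2"
      using prob_space.abs_integral_le_1[OF assms(1), of g] prob_space.abs_integral_le_1[OF assms(2), of g]
      by (auto simp: mean_gap_def)
  qed
qed (use f in simp)

section \<open>The exponential kernel is characteristic\<close>

text \<open>Along widths tending to 0 the smoothings of \<open>P\<close> and \<open>Q\<close> agree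
  almost everywhere. Tested against a bounded continuous \<open>f\<close>, they converge to the
  means of \<open>f\<close> times a common positive Gaussian mass.\<close>

lemma exp_kernel_characteristic:
  fixes P Q :: "'a::euclidean_space measure"
  assumes "prob_space P" "prob_space Q" "sets P = sets borel" "sets Q = sets borel"
    and "0 < a" "AE x in P. x \<in> S" "AE x in Q. x \<in> S"
    and "\<And>w. w \<in> S \<Longrightarrow> (\<integral>x. exp (- 2 * a * norm (x - w)) \<partial>P) = (\<integral>x. exp (- 2 * a * norm (x - w)) \<partial>Q)"
  shows "P = Q"
proof (rule prob_measure_eqI_bounded_continuous)
  fix f :: "'a \<Rightarrow> real"
  assume cont: "continuous_on UNIV f" and f: "\<And>x. \<bar>f x\<bar> \<le> 1"
  note [measurable_cong] = assms(3,4)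
  have fm[measurable]: "f \<in> borel_measurable borel" by (rule borel_measurable_continuous_onI[OF cont])
  interpret P: prob_space P by fact
  interpret Q: prob_space Q by fact
  let ?h = "\<lambda>u z x. exp (- 2 * (norm (x - z) / u)\<^sup>2) :: real"
  have "\<forall>n. \<exists>u. 0 < u \<and> u < 1 / real (Suc n) \<and> (AE z in lborel. (\<integral>x. ?h u z x \<partial>P) = (\<integral>x. ?h u z x \<partial>Q))"
    by (intro allI exp_kernel_embedding_zero[OF assms]) simp_all
  from choice[OF this] obtain u where u: "\<And>n. 0 < u n" "\<And>n. u n < 1 / real (Suc n)"
    and AE: "\<And>n. AE z in lborel. (\<integral>x. ?h (u n) z x \<partial>P) = (\<integral>x. ?h (u n) z x \<partial>Q)"
    by blast
  have u0: "u \<longlonglongrightarrow> 0"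
    by (rule tendsto_sandwich[OF _ _ tendsto_const LIMSEQ_inverse_real_of_nat])
       (use u in \<open>auto intro!: always_eventually less_imp_le simp: inverse_eq_divide\<close>)
  define A where "A M n = (\<integral>x. (\<integral>v. f (x + u n *\<^sub>R v) * exp (- 2 * (norm v)\<^sup>2) \<partial>lborel) \<partial>M)" for M n
  have A: "A P = A Q"
  proof
    fix n
    have "(\<integral>z. f z * (\<integral>x. ?h (u n) z x \<partial>P) \<partial>lborel) = (\<integral>z. f z * (\<integral>x. ?h (u n) z x \<partial>Q) \<partial>lborel)"
      by (rule integral_cong_AE) (use AE[of n] in auto)
    then have "u n ^ DIM('a) * A P n = u n ^ DIM('a) * A Q n"
      unfolding A_def gauss_smoothing_integral[OF assms(1,3) fm f u(1)] gauss_smoothing_integral[OF assms(2,4) fm f u(1)] .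
    then show "A P n = A Q n" using u(1)[of n] by simp
  qed
  have "A P \<longlonglongrightarrow> (\<integral>x. f x \<partial>P) * (\<integral>v. exp (- 2 * (norm (v::'a))\<^sup>2) \<partial>lborel)"
    unfolding A_def by (rule gauss_smoothing_tendsto) fact+
  moreover have "A Q \<longlonglongrightarrow> (\<integral>x. f x \<partial>Q) * (\<integral>v. exp (- 2 * (norm (v::'a))\<^sup>2) \<partial>lborel)"
    unfolding A_def by (rule gauss_smoothing_tendsto) fact+
  ultimately have "(\<integral>x. f x \<partial>P) * (\<integral>v. exp (- 2 * (norm (v::'a))\<^sup>2) \<partial>lborel)
      = (\<integral>x. f x \<partial>Q) * (\<integral>v. exp (- 2 * (norm (v::'a))\<^sup>2) \<partial>lborel)"
    unfolding A by (rule LIMSEQ_unique)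
  then show "(\<integral>x. f x \<partial>P) = (\<integral>x. f x \<partial>Q)"
    using integrable_gauss(2)[where c=2 and 'a='a] by simp
qed fact+

section \<open>From the maximizer to equality of the distributions\<close>

theorem theorem3p3:
  fixes Z :: "(real^'d^'m) set"
    and \<sigma> :: real
    and H :: "(real^'d^'m \<Rightarrow> real) set"
    and ip :: "(real^'d^'m \<Rightarrow> real) \<Rightarrow> (real^'d^'m \<Rightarrow> real) \<Rightarrow> real"
    and P Q :: "(real^'d^'m) measure"
    and fstar :: "real^'d^'m \<Rightarrow> real"
    and n :: nat
    and Zs :: "nat \<Rightarrow> real^'d^'m"
  assumes "Z \<in> sets borel" and "Z \<noteq> {}"
    and "\<sigma> > 0"
    and "rkhs Z (exp_kernel \<sigma>) H ip"
    and "borel_prob_on Z P" and "borel_prob_on Z Q"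
    and "maximizes_discrepancy H ip P Q fstar"
    and "\<forall>k\<in>{1..n}. Zs k \<in> Z"
    and "fstar \<in> kernel_span Z (exp_kernel \<sigma>) (Zs ` {1..n})"
    and "\<forall>k\<in>{1..n}. (LINT A|P. exp_kernel \<sigma> A (Zs k)) = (LINT A|Q. exp_kernel \<sigma> A (Zs k))"
  shows "balanced Z P Q"
proof -
  interpret rkhs Z "exp_kernel \<sigma>" H ip by fact
  have prob: "prob_space P" "prob_space Q"
    and sets: "sets P = sets (restrict_space borel Z)" "sets Q = sets (restrict_space borel Z)"
    using assms(5,6) by (auto simp: borel_prob_on_def)
  interpret P: prob_space P by fact
  interpret Q: prob_space Q by fact
  let ?K = "exp_kernel \<sigma> :: real^'d^'m \<Rightarrow> real^'d^'m \<Rightarrow> real"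
  let ?k = "kernel_section Z ?K"
  have K1: "?K w w = 1" for w by (simp add: exp_kernel_def)
  have space: "space P = Z" "space Q = Z"
    using sets[THEN sets_eq_imp_space_eq] by (simp_all add: space_restrict_space)
  have id[measurable]: "(\<lambda>x. x) \<in> measurable P borel" "(\<lambda>x. x) \<in> measurable Q borel"
    using measurable_restrict_space1[of "\<lambda>x. x" borel borel Z]
    by (simp_all add: measurable_cong_sets[OF sets(1) refl] measurable_cong_sets[OF sets(2) refl])
  have Km: "(\<lambda>x. ?K x w) \<in> borel_measurable borel" for w
    unfolding exp_kernel_def by measurable
  have K01: "0 \<le> ?K x w" "?K x w \<le> 1" for x w by (auto simp: exp_kernel_def)
  \<comment> \<open>Sections are cut off outside \<open>Z\<close>, but both measures have space
    \<open>Z\<close>, so the means are those of the kernel itself.\<close>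
  have sectP: "has_bochner_integral P (?k w) (\<integral>x. ?K x w \<partial>P)"
    and sectQ: "has_bochner_integral Q (?k w) (\<integral>x. ?K x w \<partial>Q)" for w
  proof -
    have "integrable P (\<lambda>x. ?K x w)"
      using measurable_compose[OF id(1) Km] K01 by (intro P.integrable_const_bound[where B=1]) auto
    then show "has_bochner_integral P (?k w) (\<integral>x. ?K x w \<partial>P)"
      by (subst has_bochner_integral_cong[where g="\<lambda>x. ?K x w"])
         (auto simp: kernel_section_def space has_bochner_integral_iff)
    have "integrable Q (\<lambda>x. ?K x w)"
      using measurable_compose[OF id(2) Km] K01 by (intro Q.integrable_const_bound[where B=1]) auto
    then show "has_bochner_integral Q (?k w) (\<integral>x. ?K x w \<partial>Q)"
      by (subst has_bochner_integral_cong[where g="\<lambda>x. ?K x w"])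
         (auto simp: kernel_section_def space has_bochner_integral_iff)
  qed
  from assms(9) obtain S c where S: "S \<subseteq> Zs ` {1..n}"
    and fstar: "fstar = (\<lambda>x. \<Sum>w\<in>S. c w * ?k w x)"
    by (auto simp: kernel_span_def)
  have "(\<integral>x. fstar x \<partial>P) = (\<Sum>w\<in>S. c w * (\<integral>x. ?K x w \<partial>P))"
    unfolding fstar by (intro has_bochner_integral_integral_eq has_bochner_integral_sum has_bochner_integral_mult_right sectP)
  also have "\<dots> = (\<Sum>w\<in>S. c w * (\<integral>x. ?K x w \<partial>Q))"
    using S assms(10) by (intro sum.cong) auto
  also have "\<dots> = (\<integral>x. fstar x \<partial>Q)"
    unfolding fstar
    by (intro has_bochner_integral_integral_eq[symmetric] has_bochner_integral_sum has_bochner_integral_mult_right sectQ)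
  \<comment> \<open>The gap at \<open>fstar\<close> is 0, and by maximality it equals the
    supremum.\<close>
  finally have mmd0: "mmd H ip P Q = 0"
    using assms(7) by (simp add: maximizes_discrepancy_def mean_gap_def)
  \<comment> \<open>Each section has norm 1 and so competes in the supremum. This extends equality
    of means from the points \<open>Zs k\<close> to all of \<open>Z\<close>.\<close>
  have eqK: "(\<integral>x. ?K x w \<partial>P) = (\<integral>x. ?K x w \<partial>Q)" if "w \<in> Z" for w
    using mean_gap_le_mmd[OF prob K1 section_mem[OF that]] section_norm[OF that K1] sectP[of w] sectQ[of w]
    by (simp add: mmd0 mean_gap_def has_bochner_integral_iff)
  \<comment> \<open>Chosen so that \<open>2 * a\<close> is the rate
    \<open>1 / (2 * \<sigma>\<^sup>2)\<close> of the kernel.\<close>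
  define a where "a = 1 / (4 * \<sigma>\<^sup>2)"
  have K: "?K x w = exp (- 2 * a * norm (x - w))" for x w
    by (simp add: exp_kernel_def a_def)
  \<comment> \<open>Both measures are pushed to the whole matrix space, where they are carried by
    \<open>Z\<close>; equal kernel means are available at points of \<open>Z\<close> only.\<close>
  have "distr P borel (\<lambda>x. x) = distr Q borel (\<lambda>x. x)"
  proof (rule exp_kernel_characteristic[where S=Z and a=a])
    show "prob_space (distr P borel (\<lambda>x. x))" "prob_space (distr Q borel (\<lambda>x. x))"
      by (intro P.prob_space_distr Q.prob_space_distr id)+
    show "AE x in distr P borel (\<lambda>x. x). x \<in> Z" "AE x in distr Q borel (\<lambda>x. x). x \<in> Z"
      using assms(1) space by (auto simp: AE_distr_iff)
    show "0 < a" using assms(3) by (simp add: a_def)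
    show "(\<integral>x. exp (- 2 * a * norm (x - w)) \<partial>distr P borel (\<lambda>x. x)) = (\<integral>x. exp (- 2 * a * norm (x - w)) \<partial>distr Q borel (\<lambda>x. x))"
      if "w \<in> Z" for w
      using eqK[OF that] Km[of w] by (simp only: K[symmetric] integral_distr[OF id(1) Km] integral_distr[OF id(2) Km])
  qed simp_all
  then have "P = Q"
    by (rule distr_restrict_space_borel_inject[OF assms(1) sets])
  then show ?thesis by (simp add: balanced_def)
qed

end
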